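(* Let $\alpha\in(0,1)$. Let $(\gamma_i)_{i\in\mathbb N}$ and, for every $j\in\mathbb N$, $(g_{j,i})_{i=j+1}^\infty$ be (fixed) non-negative sequences each of which sums to at most one. For every $i\in\mathbb N$ let $\tau_i\in(0,1]$ and $\lambda_i\in[0,\tau_i)$ be measurable with respect to $\mathcal G_{i-1}=\sigma(P_1,\dots,P_{i-1})$, and put $S_i=\mathbf 1\{P_i\le\tau_i\}$, $C_i=\mathbf 1\{P_i\le\lambda_i\}$. Define recursively the individual significance levels (the ADDIS-Graph) $$\alpha_i=(\tau_i-\lambda_i)\left(\alpha\gamma_i+\sum_{j=1}^{i-1}g_{j,i}\,(C_j-S_j+1)\,\frac{\alpha_j}{\tau_j-\lambda_j}\right),\qquad i\in\mathbb N .$$ Then $$\sum_{j=1}^{i}\frac{\alpha_j}{\tau_j-\lambda_j}(S_j-C_j)\le\alpha\qquad\text{for all } i\in\mathbb N .$$ Consequently, in the online testing setting with trivial conflict sets described in the context, the procedure that rejects $H_i$ if and only if $P_i\le\alpha_i$ controls the familywise error rate strongly at level $\alpha$, i.e. $\mathrm{FWER}\le\alpha$ for every configuration of true and false null hypotheses.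
   Context: Online testing setting: $(H_i)_{i\in\mathbb N}$ is a sequence of null hypotheses with p-values $(P_i)_{i\in\mathbb N}$, random variables with values in $[0,1]$. $I_0\subseteq\mathbb N$ is the index set of true null hypotheses. Each null p-value $P_i$, $i\in I_0$, is valid: $\mathbb P(P_i\le x)\le x$ for all $x\in[0,1]$. Moreover, unless $\tau_i=1$, the null p-value $P_i$, $i\in I_0$, is assumed uniformly valid: $\mathbb P(P_i\le xy\mid P_i\le y)\le x$ for all $x,y\in[0,1]$ (i.e. $\mathbb P(P_i\le xy)\le x\,\mathbb P(P_i\le y)$). Trivial conflict sets: every $P_i$ is stochastically independent of the previous p-values $(P_1,\dots,P_{i-1})$, and all of the previous p-values may be used for determining the level at step $i$. A hypothesis $H_i$ is rejected iff $P_i\le\alpha_i$. The familywise error rate is $\mathrm{FWER}=\mathbb P(\exists\, i\in I_0: P_i\le\alpha_i)$, where $\mathbb P$ is the probability under the true configuration of true and false hypotheses. *)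

theory Defs
  imports "HOL-Probability.Probability"
begin

(* Hypotheses are numbered from 1. The values at index 0 of all sequences play no role. *)

text \<open>The sigma-algebra generated by the first \<open>n\<close> p-values, as a measurable space. For
  \<open>n = 0\<close> it is the trivial sigma-algebra on the sample space.\<close>

definition pvalue_history :: "'a measure \<Rightarrow> (nat \<Rightarrow> 'a \<Rightarrow> real) \<Rightarrow> nat \<Rightarrow> 'a measure" where
  "pvalue_history M P n =
     sigma (space M) {P j -` A \<inter> space M | j A. j \<in> {1..n} \<and> A \<in> sets borel}"

text \<open>Trivial conflict sets. The vector of the previous p-values has a type different from that of
  a single p-value, so independence is stated for the generated sigma-algebras.\<close>

definition independent_of_past :: "'a measure \<Rightarrow> (nat \<Rightarrow> 'a \<Rightarrow> real) \<Rightarrow> nat \<Rightarrow> bool" where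
  "independent_of_past M P i \<longleftrightarrow>
     prob_space.indep_set M
       (sets (vimage_algebra (space M) (P i) borel)) (sets (pvalue_history M P (i - 1)))"

definition valid_pvalue :: "'a measure \<Rightarrow> ('a \<Rightarrow> real) \<Rightarrow> bool" where
  "valid_pvalue M X \<longleftrightarrow> (\<forall>x\<in>{0..1}. \<P>(\<omega> in M. X \<omega> \<le> x) \<le> x)"

(* If the conditioning event has probability 0, then the conditional probability is 0 by the
   convention for division by 0, and the inequality holds, as it does in the product form
   Pr(X <= x * y) <= x * Pr(X <= y). *)
definition uniformly_valid_pvalue :: "'a measure \<Rightarrow> ('a \<Rightarrow> real) \<Rightarrow> bool" where
  "uniformly_valid_pvalue M X \<longleftrightarrow>
     (\<forall>x\<in>{0..1}. \<forall>y\<in>{0..1}. \<P>(\<omega> in M. X \<omega> \<le> x * y \<bar> X \<omega> \<le> y) \<le> x)"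

definition pvalue_indicator :: "(nat \<Rightarrow> 'a \<Rightarrow> real) \<Rightarrow> (nat \<Rightarrow> 'a \<Rightarrow> real) \<Rightarrow> nat \<Rightarrow> 'a \<Rightarrow> real" where
  "pvalue_indicator P t i \<omega> = of_bool (P i \<omega> \<le> t i \<omega>)"

text \<open>In the definition below, \<open>pvalue_indicator P lam j\<close> and \<open>pvalue_indicator P \<tau> j\<close> are the
  variables usually written \<open>C\<^sub>j\<close> and \<open>S\<^sub>j\<close>.\<close>

fun addis_graph_level ::
  "real \<Rightarrow> (nat \<Rightarrow> real) \<Rightarrow> (nat \<Rightarrow> nat \<Rightarrow> real) \<Rightarrow> (nat \<Rightarrow> 'a \<Rightarrow> real) \<Rightarrow> (nat \<Rightarrow> 'a \<Rightarrow> real) \<Rightarrow>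
   (nat \<Rightarrow> 'a \<Rightarrow> real) \<Rightarrow> nat \<Rightarrow> 'a \<Rightarrow> real" where
  "addis_graph_level \<alpha> \<gamma> g \<tau> lam P i \<omega> =
     (\<tau> i \<omega> - lam i \<omega>) *
     (\<alpha> * \<gamma> i +
      (\<Sum>j\<in>{1..<i}. g j i * (pvalue_indicator P lam j \<omega> - pvalue_indicator P \<tau> j \<omega> + 1) *
         (addis_graph_level \<alpha> \<gamma> g \<tau> lam P j \<omega> / (\<tau> j \<omega> - lam j \<omega>))))"

declare addis_graph_level.simps [simp del]

definition FWER :: "'a measure \<Rightarrow> (nat \<Rightarrow> 'a \<Rightarrow> real) \<Rightarrow> (nat \<Rightarrow> 'a \<Rightarrow> real) \<Rightarrow> nat set \<Rightarrow> real" where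
  "FWER M P level I0 = \<P>(\<omega> in M. \<exists>i\<in>I0. P i \<omega> \<le> level i \<omega>)"

end

theory Submission
  imports Defs
begin

text \<open>Write \<open>a\<^sub>i = \<alpha>\<^sub>i / (\<tau>\<^sub>i - \<lambda>\<^sub>i)\<close> and \<open>U\<^sub>i = S\<^sub>i - C\<^sub>i\<close>. Summing the recursion
  for \<open>a\<^sub>i\<close> and exchanging the order of summation gives
  \<open>\<Sum> a\<^sub>j \<le> \<alpha> + \<Sum> (1 - U\<^sub>j) a\<^sub>j\<close>, which is the budget inequality \<open>\<Sum> a\<^sub>j U\<^sub>j \<le> \<alpha>\<close>.
  Conditionally on the past, (uniform) validity of a null p-value gives
  \<open>Pr(P\<^sub>i \<le> \<alpha>\<^sub>i) \<le> a\<^sub>i Pr(\<lambda>\<^sub>i < P\<^sub>i \<le> \<tau>\<^sub>i)\<close>. Summing over the nulls, the union bound bounds the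
  FWER by the expectation of \<open>\<Sum> a\<^sub>j U\<^sub>j\<close>.\<close>

section \<open>Deterministic bounds for the graph recursion\<close>

lemma graph_weight_nonneg:
  fixes a u \<gamma> :: "nat \<Rightarrow> real" and g :: "nat \<Rightarrow> nat \<Rightarrow> real"
  assumes rec: "\<And>i. i \<in> {1..n} \<Longrightarrow> a i = \<alpha> * \<gamma> i + (\<Sum>j\<in>{1..<i}. g j i * (1 - u j) * a j)"
    and "\<alpha> \<ge> 0" and "\<And>i. i \<ge> 1 \<Longrightarrow> \<gamma> i \<ge> 0"
    and "\<And>j i. j \<ge> 1 \<Longrightarrow> i > j \<Longrightarrow> g j i \<ge> 0"
    and "\<And>j. j \<in> {1..n} \<Longrightarrow> u j \<le> 1"
    and "i \<in> {1..n}"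
  shows "a i \<ge> 0"
  using \<open>i \<in> {1..n}\<close>
proof (induction i rule: less_induct)
  case (less i)
  have "0 \<le> g j i * (1 - u j) * a j" if "j \<in> {1..<i}" for j
    using that less assms(4)[of j i] assms(5)[of j] by auto
  then have "0 \<le> (\<Sum>j\<in>{1..<i}. g j i * (1 - u j) * a j)"
    by (rule sum_nonneg)
  with assms(2,3) less.prems show ?case
    by (simp add: rec)
qed

text \<open>Mass balance: since \<open>g j\<close> sums to at most one, node \<open>j\<close> passes
  on at most \<open>(1 - u j) * a j\<close>, so \<open>a j * u j\<close> is charged to the initial
  supply, which is at most \<alpha>. Plain real sequences are used so that the bound applies at each
  sample point separately.\<close>

lemma graph_spent_le:
  fixes a u \<gamma> :: "nat \<Rightarrow> real" and g :: "nat \<Rightarrow> nat \<Rightarrow> real"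
  assumes rec: "\<And>i. i \<in> {1..n} \<Longrightarrow> a i = \<alpha> * \<gamma> i + (\<Sum>j\<in>{1..<i}. g j i * (1 - u j) * a j)"
    and \<alpha>: "\<alpha> \<ge> 0" and \<gamma>: "\<And>i. i \<ge> 1 \<Longrightarrow> \<gamma> i \<ge> 0"
    and \<gamma>_sum: "\<gamma> summable_on {1..}" "infsum \<gamma> {1..} \<le> 1"
    and g: "\<And>j i. j \<ge> 1 \<Longrightarrow> i > j \<Longrightarrow> g j i \<ge> 0"
    and g_sum: "\<And>j. j \<ge> 1 \<Longrightarrow> g j summable_on {j+1..}" "\<And>j. j \<ge> 1 \<Longrightarrow> infsum (g j) {j+1..} \<le> 1"
    and u: "\<And>j. j \<in> {1..n} \<Longrightarrow> u j \<le> 1"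
  shows "(\<Sum>j\<in>{1..n}. a j * u j) \<le> \<alpha>"
proof -
  have a_nonneg: "a i \<ge> 0" if "i \<in> {1..n}" for i
    by (rule graph_weight_nonneg[OF rec \<alpha> \<gamma> g u that])
  have \<gamma>_le: "sum \<gamma> {1..n} \<le> 1"
    using finite_sum_le_infsum[OF \<gamma>_sum(1), of "{1..n}"] \<gamma> \<gamma>_sum(2) by fastforce
  have g_le: "(\<Sum>i\<in>{j+1..n}. g j i) \<le> 1" if "j \<ge> 1" for j
    using finite_sum_le_infsum[OF g_sum(1)[OF that], of "{j+1..n}"] g[OF that] g_sum(2)[OF that]
    by fastforce
  have "(\<Sum>i\<in>{1..n}. a i)
      = (\<Sum>i\<in>{1..n}. \<alpha> * \<gamma> i + (\<Sum>j\<in>{1..<i}. g j i * (1 - u j) * a j))"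
    by (rule sum.cong[OF refl rec])
  also have "\<dots>
      = \<alpha> * sum \<gamma> {1..n} + (\<Sum>i\<in>{1..n}. \<Sum>j\<in>{1..<i}. g j i * (1 - u j) * a j)"
    by (simp add: sum.distrib sum_distrib_left)
  \<comment> \<open>Both double sums run over the triangle of pairs with
    \<open>1 \<le> j < i \<le> n\<close>: first grouped by the receiving node \<open>i\<close>, then
    by the giving node \<open>j\<close>.\<close>
  also have "(\<Sum>i\<in>{1..n}. \<Sum>j\<in>{1..<i}. g j i * (1 - u j) * a j)
      = (\<Sum>j\<in>{1..n}. \<Sum>i\<in>{j+1..n}. g j i * (1 - u j) * a j)"
    by (subst (1 2) sum.Sigma, simp, simp, simp, simp)
       (rule sum.reindex_bij_witness[of _ "\<lambda>(j, i). (i, j)" "\<lambda>(i, j). (j, i)"]; auto)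
  also have "\<dots> = (\<Sum>j\<in>{1..n}. (\<Sum>i\<in>{j+1..n}. g j i) * ((1 - u j) * a j))"
    by (simp add: sum_distrib_right mult.assoc)
  also have "\<dots> \<le> (\<Sum>j\<in>{1..n}. 1 * ((1 - u j) * a j))"
    using a_nonneg u g_le by (intro sum_mono mult_right_mono mult_nonneg_nonneg) auto
  also have "\<alpha> * sum \<gamma> {1..n} \<le> \<alpha>"
    using mult_left_mono[OF \<gamma>_le \<alpha>] by simp
  finally show ?thesis
    by (simp add: algebra_simps sum_subtractf)
qed

text \<open>The weight \<open>a n\<close> does not depend on \<open>u n\<close>, so all of it can be charged to the budget.\<close>

lemma graph_weight_le:
  fixes a u \<gamma> :: "nat \<Rightarrow> real" and g :: "nat \<Rightarrow> nat \<Rightarrow> real"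
  assumes rec: "\<And>i. i \<in> {1..n} \<Longrightarrow> a i = \<alpha> * \<gamma> i + (\<Sum>j\<in>{1..<i}. g j i * (1 - u j) * a j)"
    and \<alpha>: "\<alpha> \<ge> 0" and \<gamma>: "\<And>i. i \<ge> 1 \<Longrightarrow> \<gamma> i \<ge> 0"
    and \<gamma>_sum: "\<gamma> summable_on {1..}" "infsum \<gamma> {1..} \<le> 1"
    and g: "\<And>j i. j \<ge> 1 \<Longrightarrow> i > j \<Longrightarrow> g j i \<ge> 0"
    and g_sum: "\<And>j. j \<ge> 1 \<Longrightarrow> g j summable_on {j+1..}" "\<And>j. j \<ge> 1 \<Longrightarrow> infsum (g j) {j+1..} \<le> 1"
    and u: "\<And>j. j \<in> {1..n} \<Longrightarrow> u j \<in> {0..1}" and n: "n \<ge> 1"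
  shows "a n \<le> \<alpha>"
proof -
  have rec': "a i = \<alpha> * \<gamma> i + (\<Sum>j\<in>{1..<i}. g j i * (1 - (u(n := 1)) j) * a j)"
    if "i \<in> {1..n}" for i
    using that by (subst rec[OF that]) (auto intro!: sum.cong)
  have "a n \<le> (\<Sum>j\<in>{1..n}. a j * (u(n := 1)) j)"
  \<comment> \<open>With \<open>u n\<close> set to 1, the summand at \<open>n\<close> is
    \<open>a n\<close> itself, and the remaining summands are nonnegative.\<close>
  proof (rule order_trans[OF _ member_le_sum[of n]])
    fix j assume j: "j \<in> {1..n} - {n}"
    have "a j \<ge> 0"
      using u j by (intro graph_weight_nonneg[OF rec \<alpha> \<gamma> g]) auto
    then show "0 \<le> a j * (u(n := 1)) j"
      using u j by simp
  qed (use n in auto)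
  also have "\<dots> \<le> \<alpha>"
    using u by (intro graph_spent_le[OF rec' \<alpha> \<gamma> \<gamma>_sum g g_sum]) auto
  finally show ?thesis .
qed

section \<open>Tonelli's theorem under independence\<close>

text \<open>The product rule on events makes the joint law of \<open>X\<close> and \<open>Y\<close>
  a product measure, and Tonelli's theorem then integrates out \<open>X\<close> first. The target
  spaces may have different types, so \<open>T\<close> can be the sample space with a coarser
  sigma-algebra.\<close>

lemma (in prob_space) nn_integral_indep:
  assumes X: "X \<in> measurable M S" and Y: "Y \<in> measurable M T"
    and indep: "\<And>A B. A \<in> sets S \<Longrightarrow> B \<in> sets T \<Longrightarrow>
      prob ((X -` A \<inter> space M) \<inter> (Y -` B \<inter> space M)) =
      prob (X -` A \<inter> space M) * prob (Y -` B \<inter> space M)"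
    and f: "f \<in> borel_measurable (S \<Otimes>\<^sub>M T)"
  shows "(\<integral>\<^sup>+ \<omega>. f (X \<omega>, Y \<omega>) \<partial>M) = (\<integral>\<^sup>+ \<omega>. (\<integral>\<^sup>+ \<omega>'. f (X \<omega>', Y \<omega>) \<partial>M) \<partial>M)"
proof -
  interpret DX: prob_space "distr M S X" by (rule prob_space_distr[OF X])
  interpret DY: prob_space "distr M T Y" by (rule prob_space_distr[OF Y])
  interpret DXY: pair_sigma_finite "distr M S X" "distr M T Y" ..
  note [measurable] = X Y f
  \<comment> \<open>Sigma-finite product measures are determined by their values on rectangles, and
    there \<open>indep\<close> applies directly.\<close>
  have joint: "distr M S X \<Otimes>\<^sub>M distr M T Y = distr M (S \<Otimes>\<^sub>M T) (\<lambda>\<omega>. (X \<omega>, Y \<omega>))"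
  proof (rule pair_measure_eqI)
    fix A B assume "A \<in> sets (distr M S X)" "B \<in> sets (distr M T Y)"
    then have [measurable]: "A \<in> sets S" "B \<in> sets T" by auto
    have "(\<lambda>\<omega>. (X \<omega>, Y \<omega>)) -` (A \<times> B) \<inter> space M = (X -` A \<inter> space M) \<inter> (Y -` B \<inter> space M)"
      by auto
    then show "emeasure (distr M S X) A * emeasure (distr M T Y) B =
        emeasure (distr M (S \<Otimes>\<^sub>M T) (\<lambda>\<omega>. (X \<omega>, Y \<omega>))) (A \<times> B)"
      using indep[of A B] by (simp add: emeasure_distr emeasure_eq_measure ennreal_mult)
  qed (simp_all add: DX.sigma_finite_measure_axioms DY.sigma_finite_measure_axioms
      cong: sets_pair_measure_cong)
  have "(\<integral>\<^sup>+ \<omega>. f (X \<omega>, Y \<omega>) \<partial>M) = (\<integral>\<^sup>+ z. f z \<partial>(distr M S X \<Otimes>\<^sub>M distr M T Y))"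
    unfolding joint by (subst nn_integral_distr) auto
  also have "\<dots> = (\<integral>\<^sup>+ y. (\<integral>\<^sup>+ x. f (x, y) \<partial>distr M S X) \<partial>distr M T Y)"
    by (rule DXY.nn_integral_snd[symmetric]) measurable
  also have "\<dots> = (\<integral>\<^sup>+ \<omega>. (\<integral>\<^sup>+ x. f (x, Y \<omega>) \<partial>distr M S X) \<partial>M)"
    by (subst nn_integral_distr) measurable
  also have "\<dots> = (\<integral>\<^sup>+ \<omega>. (\<integral>\<^sup>+ \<omega>'. f (X \<omega>', Y \<omega>) \<partial>M) \<partial>M)"
    using measurable_space[OF Y]
    by (intro nn_integral_cong) (subst nn_integral_distr, measurable)
  finally show ?thesis .
qed

lemma nn_integral_of_bool:
  assumes "{x\<in>space M. Q x} \<in> sets M"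
  shows "(\<integral>\<^sup>+ x. ennreal (of_bool (Q x)) \<partial>M) = emeasure M {x\<in>space M. Q x}"
  by (subst nn_integral_indicator[OF assms, symmetric]) (rule nn_integral_cong, simp)

section \<open>Probability bounds from validity and uniform validity\<close>

lemma (in prob_space) prob_interval:
  fixes X :: "'a \<Rightarrow> real"
  assumes [measurable]: "X \<in> borel_measurable M" and "l \<le> t"
  shows "\<P>(\<omega> in M. l < X \<omega> \<and> X \<omega> \<le> t) = \<P>(\<omega> in M. X \<omega> \<le> t) - \<P>(\<omega> in M. X \<omega> \<le> l)"
proof -
  have "{\<omega>\<in>space M. l < X \<omega> \<and> X \<omega> \<le> t} = {\<omega>\<in>space M. X \<omega> \<le> t} - {\<omega>\<in>space M. X \<omega> \<le> l}"
    using \<open>l \<le> t\<close> by auto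
  then show ?thesis
    using \<open>l \<le> t\<close> by (simp only:) (rule finite_measure_Diff; force)
qed

text \<open>The scaling property is used twice. The factor \<open>a * (t - l) / t\<close> bounds the
  left side by a multiple of \<open>Pr(X \<le> t)\<close>; the factor \<open>l / t\<close> bounds
  \<open>Pr(X \<le> l)\<close> from above, so the interval keeps at least the share
  \<open>(t - l) / t\<close> of \<open>Pr(X \<le> t)\<close>. Scaling is assumed at the single point
  \<open>t\<close> only, so that plain validity suffices when \<open>t = 1\<close>.\<close>

lemma (in prob_space) prob_le_weighted_interval:
  assumes X [measurable]: "X \<in> borel_measurable M"
    and scaled: "\<And>x. x \<in> {0..1} \<Longrightarrow> \<P>(\<omega> in M. X \<omega> \<le> x * t) \<le> x * \<P>(\<omega> in M. X \<omega> \<le> t)"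
    and l: "0 \<le> l" "l < t" and a: "a \<in> {0..1}"
  shows "\<P>(\<omega> in M. X \<omega> \<le> (t - l) * a) \<le> a * \<P>(\<omega> in M. l < X \<omega> \<and> X \<omega> \<le> t)"
proof -
  let ?x = "(t - l) / t"
  have "?x \<in> {0..1}" using l by (auto simp: field_simps)
  then have "a * ?x \<in> {0..1}" using a by (simp add: mult_le_one del: times_divide_eq_right)
  from scaled[OF this] have "\<P>(\<omega> in M. X \<omega> \<le> (t - l) * a) \<le> a * (?x * \<P>(\<omega> in M. X \<omega> \<le> t))"
    using l by (simp add: mult_ac)
  also have "?x * \<P>(\<omega> in M. X \<omega> \<le> t) \<le> \<P>(\<omega> in M. l < X \<omega> \<and> X \<omega> \<le> t)"
    using scaled[of "l / t"] l prob_interval[OF X, of l t] by (simp add: diff_divide_distrib algebra_simps)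
  finally show ?thesis using a by (simp add: mult_left_mono)
qed

lemma (in prob_space) uniformly_valid_pvalue_scaled:
  assumes [measurable]: "X \<in> borel_measurable M" and "uniformly_valid_pvalue M X"
    and x: "x \<in> {0..1}" and y: "y \<in> {0..1}"
  shows "\<P>(\<omega> in M. X \<omega> \<le> x * y) \<le> x * \<P>(\<omega> in M. X \<omega> \<le> y)"
proof -
  have xy: "x * y \<le> y" using x y by (simp add: mult_left_le_one_le)
  then have "{\<omega>\<in>space M. X \<omega> \<le> x * y \<and> X \<omega> \<le> y} = {\<omega>\<in>space M. X \<omega> \<le> x * y}"
    by auto
  moreover have "\<P>(\<omega> in M. X \<omega> \<le> x * y \<bar> X \<omega> \<le> y) \<le> x"
    using assms by (auto simp: uniformly_valid_pvalue_def)
  ultimately have le: "\<P>(\<omega> in M. X \<omega> \<le> x * y) / \<P>(\<omega> in M. X \<omega> \<le> y) \<le> x"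
    by (simp add: cond_prob_def)
  show ?thesis
  proof (cases "\<P>(\<omega> in M. X \<omega> \<le> y) = 0")
    \<comment> \<open>With a null conditioning event the quotient carries no information;
      monotonicity makes the left side zero as well.\<close>
    case True
    have "\<P>(\<omega> in M. X \<omega> \<le> x * y) \<le> \<P>(\<omega> in M. X \<omega> \<le> y)"
      using xy by (intro finite_measure_mono) auto
    with True show ?thesis by simp
  next
    case False
    then have "\<P>(\<omega> in M. X \<omega> \<le> y) > 0"
      by (simp add: zero_less_measure_iff)
    with le show ?thesis by (simp add: divide_le_eq)
  qed
qed

text \<open>At threshold 1 the event \<open>X \<le> 1\<close> is certain, so plain validity already
  is the scaling property. The factor \<open>1\<close> stays visible to match that property at
  \<open>t = 1\<close>.\<close>

lemma (in prob_space) valid_pvalue_scaled: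
  assumes "valid_pvalue M X" and "\<And>\<omega>. \<omega> \<in> space M \<Longrightarrow> X \<omega> \<le> 1" and "x \<in> {0..1}"
  shows "\<P>(\<omega> in M. X \<omega> \<le> x * 1) \<le> x * \<P>(\<omega> in M. X \<omega> \<le> 1)"
proof -
  have "{\<omega>\<in>space M. X \<omega> \<le> 1} = space M" using assms(2) by auto
  with assms show ?thesis by (simp add: valid_pvalue_def prob_space)
qed

section \<open>The filtration generated by the p-values\<close>

lemma space_pvalue_history [simp]: "space (pvalue_history M P n) = space M"
  by (auto simp: pvalue_history_def space_measure_of_conv)

lemma sets_pvalue_history:
  "sets (pvalue_history M P n) =
     sigma_sets (space M) {P j -` A \<inter> space M | j A. j \<in> {1..n} \<and> A \<in> sets borel}"
  unfolding pvalue_history_def by (rule sets_measure_of) auto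

lemma sets_pvalue_history_mono:
  "m \<le> n \<Longrightarrow> sets (pvalue_history M P m) \<subseteq> sets (pvalue_history M P n)"
  unfolding sets_pvalue_history by (rule sigma_sets_mono') fastforce

lemma measurable_pvalue_history_mono:
  "f \<in> measurable (pvalue_history M P m) N \<Longrightarrow> m \<le> n \<Longrightarrow> f \<in> measurable (pvalue_history M P n) N"
  using sets_pvalue_history_mono[of m n M P] by (auto simp: measurable_def)

lemma measurable_pvalue_history:
  "j \<in> {1..n} \<Longrightarrow> P j \<in> borel_measurable (pvalue_history M P n)"
  by (rule measurableI) (auto simp: sets_pvalue_history intro!: sigma_sets.Basic)

lemma sets_pvalue_history_subset:
  assumes "\<And>j. j \<ge> 1 \<Longrightarrow> P j \<in> borel_measurable M"
  shows "sets (pvalue_history M P n) \<subseteq> sets M"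
  unfolding sets_pvalue_history
  using assms by (intro sets.sigma_sets_subset) (auto intro: measurable_sets)

lemma measurable_from_pvalue_history:
  assumes P: "\<And>j. j \<ge> 1 \<Longrightarrow> P j \<in> borel_measurable M"
    and f: "f \<in> measurable (pvalue_history M P n) N"
  shows "f \<in> measurable M N"
proof (rule measurableI)
  fix A assume "A \<in> sets N"
  then have "f -` A \<inter> space M \<in> sets (pvalue_history M P n)"
    using measurable_sets[OF f] by simp
  then show "f -` A \<inter> space M \<in> sets M"
    using sets_pvalue_history_subset[where P = P and M = M and n = n] P by blast
qed (use measurable_space[OF f] in simp)

section \<open>Conditioning a p-value on its past\<close>

lemma (in prob_space) nn_integral_independent_of_past:
  assumes P: "\<And>j. j \<ge> 1 \<Longrightarrow> P j \<in> borel_measurable M" and i: "i \<ge> 1"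
    and indep: "independent_of_past M P i"
    and f: "f \<in> borel_measurable (borel \<Otimes>\<^sub>M pvalue_history M P (i - 1))"
  shows "(\<integral>\<^sup>+ \<omega>. f (P i \<omega>, \<omega>) \<partial>M) = (\<integral>\<^sup>+ \<omega>. (\<integral>\<^sup>+ \<omega>'. f (P i \<omega>', \<omega>) \<partial>M) \<partial>M)"
proof (rule nn_integral_indep[where Y = "\<lambda>\<omega>. \<omega>", OF P[OF i] _ _ f])
  let ?H = "pvalue_history M P (i - 1)"
  show "(\<lambda>\<omega>. \<omega>) \<in> measurable M ?H"
    by (rule measurable_from_pvalue_history[OF P measurable_ident_sets[OF refl]])
  fix A B assume A: "A \<in> sets (borel :: real measure)" and B: "B \<in> sets ?H"
  have "(\<lambda>\<omega>. \<omega>) -` B \<inter> space M = B"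
    using B sets.sets_into_space[of B ?H] by auto
  with indep_setD[OF indep[unfolded independent_of_past_def], of "P i -` A \<inter> space M" B] A B
  show "prob ((P i -` A \<inter> space M) \<inter> ((\<lambda>\<omega>. \<omega>) -` B \<inter> space M)) =
      prob (P i -` A \<inter> space M) * prob ((\<lambda>\<omega>. \<omega>) -` B \<inter> space M)"
    by (simp add: in_vimage_algebra)
qed

text \<open>Once the past is frozen, \<open>t\<close>, \<open>l\<close> and \<open>a\<close> are
  constants and \<open>prob_le_weighted_interval\<close> applies to \<open>P i\<close>. Independence
  is used once to freeze the past and once to release it.\<close>

lemma (in prob_space) emeasure_rejection_le:
  assumes P: "\<And>j. j \<ge> 1 \<Longrightarrow> P j \<in> borel_measurable M" and i: "i \<ge> 1"
    and P_le: "\<And>\<omega>. \<omega> \<in> space M \<Longrightarrow> P i \<omega> \<le> 1"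
    and indep: "independent_of_past M P i"
    and valid: "valid_pvalue M (P i)"
    and unif: "\<not> (AE \<omega> in M. t \<omega> = 1) \<Longrightarrow> uniformly_valid_pvalue M (P i)"
    and meas [measurable]: "t \<in> borel_measurable (pvalue_history M P (i - 1))"
      "l \<in> borel_measurable (pvalue_history M P (i - 1))"
      "a \<in> borel_measurable (pvalue_history M P (i - 1))"
    and t: "\<And>\<omega>. \<omega> \<in> space M \<Longrightarrow> t \<omega> \<in> {0<..1}"
    and l: "\<And>\<omega>. \<omega> \<in> space M \<Longrightarrow> l \<omega> \<in> {0..<t \<omega>}"
    and a: "\<And>\<omega>. \<omega> \<in> space M \<Longrightarrow> a \<omega> \<in> {0..1}"
  shows "emeasure M {\<omega>\<in>space M. P i \<omega> \<le> (t \<omega> - l \<omega>) * a \<omega>}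
    \<le> (\<integral>\<^sup>+ \<omega>. ennreal (a \<omega> * of_bool (l \<omega> < P i \<omega> \<and> P i \<omega> \<le> t \<omega>)) \<partial>M)"
proof -
  let ?H = "pvalue_history M P (i - 1)"
  note [measurable] = P[OF i]
  have HM: "f \<in> borel_measurable M" if "f \<in> borel_measurable ?H" for f :: "'a \<Rightarrow> real"
    by (rule measurable_from_pvalue_history[OF P that])
  note [measurable] = HM[OF meas(1)] HM[OF meas(2)] HM[OF meas(3)]
  \<comment> \<open>When \<open>t\<close> is almost surely 1 only plain validity is available, hence
    the scaling property is obtained almost everywhere rather than at every sample point.\<close>
  have scaled: "AE \<omega> in M. \<forall>x\<in>{0..1}. \<P>(\<omega>' in M. P i \<omega>' \<le> x * t \<omega>) \<le> x * \<P>(\<omega>' in M. P i \<omega>' \<le> t \<omega>)"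
  proof (cases "AE \<omega> in M. t \<omega> = 1")
    case True
    then show ?thesis
      using valid_pvalue_scaled[OF valid P_le] by (auto elim!: eventually_mono)
  next
    case False
    show ?thesis
      using t uniformly_valid_pvalue_scaled[OF P[OF i] unif[OF False]]
      by (intro AE_I2) (auto simp: less_imp_le)
  qed
  have "emeasure M {\<omega>\<in>space M. P i \<omega> \<le> (t \<omega> - l \<omega>) * a \<omega>}
      = (\<integral>\<^sup>+ \<omega>. ennreal (of_bool (P i \<omega> \<le> (t \<omega> - l \<omega>) * a \<omega>)) \<partial>M)"
    by (rule nn_integral_of_bool[symmetric]) measurable
  also have "\<dots> = (\<integral>\<^sup>+ \<omega>. (\<integral>\<^sup>+ \<omega>'. ennreal (of_bool (P i \<omega>' \<le> (t \<omega> - l \<omega>) * a \<omega>)) \<partial>M) \<partial>M)"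
    using nn_integral_independent_of_past[OF P i indep,
      of "\<lambda>(x, \<omega>). ennreal (of_bool (x \<le> (t \<omega> - l \<omega>) * a \<omega>))"] by (simp del: One_nat_def)
  also have "\<dots> \<le> (\<integral>\<^sup>+ \<omega>. (\<integral>\<^sup>+ \<omega>'. ennreal (a \<omega> * of_bool (l \<omega> < P i \<omega>' \<and> P i \<omega>' \<le> t \<omega>)) \<partial>M) \<partial>M)"
  proof (rule nn_integral_mono_AE, use scaled AE_space in eventually_elim)
    case (elim \<omega>)
    have "(\<integral>\<^sup>+ \<omega>'. ennreal (of_bool (P i \<omega>' \<le> (t \<omega> - l \<omega>) * a \<omega>)) \<partial>M)
        = ennreal (\<P>(\<omega>' in M. P i \<omega>' \<le> (t \<omega> - l \<omega>) * a \<omega>))"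
      unfolding emeasure_eq_measure[symmetric] by (rule nn_integral_of_bool) measurable
    also have "\<dots> \<le> ennreal (a \<omega> * \<P>(\<omega>' in M. l \<omega> < P i \<omega>' \<and> P i \<omega>' \<le> t \<omega>))"
      using elim a[of \<omega>] l[of \<omega>] by (intro ennreal_leI prob_le_weighted_interval) auto
    also have "\<dots> = ennreal (a \<omega>) * emeasure M {\<omega>'\<in>space M. l \<omega> < P i \<omega>' \<and> P i \<omega>' \<le> t \<omega>}"
      using a[of \<omega>] elim by (simp add: emeasure_eq_measure ennreal_mult)
    also have "\<dots> = (\<integral>\<^sup>+ \<omega>'. ennreal (a \<omega> * of_bool (l \<omega> < P i \<omega>' \<and> P i \<omega>' \<le> t \<omega>)) \<partial>M)"
      by (subst nn_integral_cmult_indicator[symmetric])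
         (auto intro!: nn_integral_cong simp: indicator_def)
    finally show ?case .
  qed
  also have "\<dots> = (\<integral>\<^sup>+ \<omega>. ennreal (a \<omega> * of_bool (l \<omega> < P i \<omega> \<and> P i \<omega> \<le> t \<omega>)) \<partial>M)"
    using nn_integral_independent_of_past[OF P i indep,
      of "\<lambda>(x, \<omega>). ennreal (a \<omega> * of_bool (l \<omega> < x \<and> x \<le> t \<omega>))"] by (simp del: One_nat_def)
  finally show ?thesis .
qed

section \<open>Budget inequality and familywise error control\<close>

theorem theorem3p1:
  fixes M :: "'a measure"
    and P \<tau> lam :: "nat \<Rightarrow> 'a \<Rightarrow> real"
    and \<alpha> :: real
    and \<gamma> :: "nat \<Rightarrow> real"
    and g :: "nat \<Rightarrow> nat \<Rightarrow> real"
  assumes "prob_space M"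
    and "\<And>i. i \<ge> 1 \<Longrightarrow> P i \<in> borel_measurable M"
    and "\<And>i \<omega>. i \<ge> 1 \<Longrightarrow> \<omega> \<in> space M \<Longrightarrow> P i \<omega> \<in> {0..1}"
    and "\<alpha> \<in> {0<..<1}"
    and "\<And>i. i \<ge> 1 \<Longrightarrow> \<gamma> i \<ge> 0"
    and "\<gamma> summable_on {1..}"
    and "infsum \<gamma> {1..} \<le> 1"
    and "\<And>j i. j \<ge> 1 \<Longrightarrow> i > j \<Longrightarrow> g j i \<ge> 0"
    and "\<And>j. j \<ge> 1 \<Longrightarrow> g j summable_on {j+1..}"
    and "\<And>j. j \<ge> 1 \<Longrightarrow> infsum (g j) {j+1..} \<le> 1"
    and "\<And>i. i \<ge> 1 \<Longrightarrow> \<tau> i \<in> borel_measurable (pvalue_history M P (i - 1))"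
    and "\<And>i. i \<ge> 1 \<Longrightarrow> lam i \<in> borel_measurable (pvalue_history M P (i - 1))"
    and "\<And>i \<omega>. i \<ge> 1 \<Longrightarrow> \<omega> \<in> space M \<Longrightarrow> \<tau> i \<omega> \<in> {0<..1}"
    and "\<And>i \<omega>. i \<ge> 1 \<Longrightarrow> \<omega> \<in> space M \<Longrightarrow> lam i \<omega> \<in> {0..<\<tau> i \<omega>}"
  shows "(\<forall>\<omega>\<in>space M. \<forall>i\<ge>1.
            (\<Sum>j\<in>{1..i}. addis_graph_level \<alpha> \<gamma> g \<tau> lam P j \<omega> / (\<tau> j \<omega> - lam j \<omega>) *
               (pvalue_indicator P \<tau> j \<omega> - pvalue_indicator P lam j \<omega>)) \<le> \<alpha>) \<and>
         (\<forall>I0 \<subseteq> {1..}.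
            (\<forall>i\<ge>1. independent_of_past M P i) \<longrightarrow>
            (\<forall>i\<in>I0. valid_pvalue M (P i)) \<longrightarrow>
            (\<forall>i\<in>I0. \<not> (AE \<omega> in M. \<tau> i \<omega> = 1) \<longrightarrow> uniformly_valid_pvalue M (P i)) \<longrightarrow>
            FWER M P (addis_graph_level \<alpha> \<gamma> g \<tau> lam P) I0 \<le> \<alpha>)"
proof -
  interpret prob_space M by fact
  note P = assms(2) and P01 = assms(3)
    and \<tau>_meas = assms(11) and lam_meas = assms(12)
    and \<tau> = assms(13) and lam = assms(14)
  have \<alpha>: "\<alpha> \<ge> 0" "\<alpha> \<le> 1" using assms(4) by auto
  let ?level = "addis_graph_level \<alpha> \<gamma> g \<tau> lam P"
  define a where "a i \<omega> = ?level i \<omega> / (\<tau> i \<omega> - lam i \<omega>)" for i \<omega>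
  define u where "u i \<omega> = pvalue_indicator P \<tau> i \<omega> - pvalue_indicator P lam i \<omega>" for i \<omega>
  have pos: "\<tau> i \<omega> - lam i \<omega> > 0" if "i \<ge> 1" "\<omega> \<in> space M" for i \<omega>
    using lam[OF that] by simp
  \<comment> \<open>Because \<open>lam i \<omega> < \<tau> i \<omega>\<close>, the difference of
    indicators is itself the indicator of a half-open interval.\<close>
  have u_eq: "u i \<omega> = of_bool (lam i \<omega> < P i \<omega> \<and> P i \<omega> \<le> \<tau> i \<omega>)" if "i \<ge> 1" "\<omega> \<in> space M" for i \<omega>
    using pos[OF that] by (auto simp: u_def pvalue_indicator_def)
  then have u01: "u i \<omega> \<in> {0..1}" if "i \<ge> 1" "\<omega> \<in> space M" for i \<omega>
    using that by simp
  have level: "?level i \<omega> = (\<tau> i \<omega> - lam i \<omega>) * a i \<omega>" if "i \<ge> 1" "\<omega> \<in> space M" for i \<omega>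
    using pos[OF that] by (simp add: a_def)
  have rec: "a i \<omega> = \<alpha> * \<gamma> i + (\<Sum>j\<in>{1..<i}. g j i * (1 - u j \<omega>) * a j \<omega>)"
    if "i \<ge> 1" "\<omega> \<in> space M" for i \<omega>
  proof -
    have "?level i \<omega> = (\<tau> i \<omega> - lam i \<omega>) *
        (\<alpha> * \<gamma> i + (\<Sum>j\<in>{1..<i}. g j i * (1 - u j \<omega>) * a j \<omega>))"
      unfolding a_def u_def by (subst addis_graph_level.simps) (simp add: algebra_simps)
    with pos[OF that] show ?thesis by (simp add: a_def)
  qed
  have a_nonneg: "0 \<le> a i \<omega>" if "i \<ge> 1" "\<omega> \<in> space M" for i \<omega>
    by (rule graph_weight_nonneg[where n = i and a = "\<lambda>i. a i \<omega>" and u = "\<lambda>i. u i \<omega>"])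
       (use that rec u01 \<alpha> assms in auto)
  have spent: "(\<Sum>j\<in>{1..i}. a j \<omega> * u j \<omega>) \<le> \<alpha>" if "\<omega> \<in> space M" for i \<omega>
    by (rule graph_spent_le[where a = "\<lambda>i. a i \<omega>" and u = "\<lambda>i. u i \<omega>" and \<gamma> = \<gamma> and g = g])
       (use that rec u01 \<alpha> assms in auto)
  \<comment> \<open>Together with \<open>\<alpha> \<le> 1\<close> this places
    \<open>a i \<omega>\<close> in the unit interval, as the scaling argument demands.\<close>
  have a_le: "a i \<omega> \<le> \<alpha>" if "i \<ge> 1" "\<omega> \<in> space M" for i \<omega>
    by (rule graph_weight_le[where a = "\<lambda>i. a i \<omega>" and u = "\<lambda>i. u i \<omega>" and \<gamma> = \<gamma> and g = g])
       (use that rec u01 \<alpha> assms in auto)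
  \<comment> \<open>The weight \<open>a i\<close> is predictable: it involves indicators and weights
    only for \<open>j < i\<close>. Here \<open>P j\<close> belongs to the history up to
    \<open>i - 1\<close> since \<open>j \<le> i - 1\<close>, and \<open>\<tau> j\<close>,
    \<open>lam j\<close>, \<open>a j\<close> already belong to the history up to
    \<open>j - 1\<close>.\<close>
  have a_meas: "a i \<in> borel_measurable (pvalue_history M P (i - 1))" if "i \<ge> 1" for i
    using that
  proof (induction i rule: less_induct)
    case (less i)
    let ?H = "pvalue_history M P (i - 1)"
    have "(\<lambda>\<omega>. g j i * (1 - u j \<omega>) * a j \<omega>) \<in> borel_measurable ?H" if j: "j \<in> {1..<i}" for j
    proof -
      have [measurable]: "\<tau> j \<in> borel_measurable ?H" "lam j \<in> borel_measurable ?H"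
        "a j \<in> borel_measurable ?H"
        using j less.IH[of j] \<tau>_meas[of j] lam_meas[of j]
        by (auto intro: measurable_pvalue_history_mono[of _ M P "j - 1"])
      have [measurable]: "P j \<in> borel_measurable ?H"
        using j by (intro measurable_pvalue_history) auto
      show ?thesis unfolding u_def pvalue_indicator_def by measurable
    qed
    then have "(\<lambda>\<omega>. \<alpha> * \<gamma> i + (\<Sum>j\<in>{1..<i}. g j i * (1 - u j \<omega>) * a j \<omega>)) \<in> borel_measurable ?H"
      by (intro borel_measurable_add borel_measurable_sum) auto
    then show ?case
      using less.prems by (subst measurable_cong[OF rec]) auto
  qed
  have M_meas: "a i \<in> borel_measurable M" "\<tau> i \<in> borel_measurable M" "lam i \<in> borel_measurable M"
    if "i \<ge> 1" for i
    using that a_meas \<tau>_meas lam_meas by (simp_all add: measurable_from_pvalue_history[where P = P and n = "i - 1"] P)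
  have "FWER M P ?level I0 \<le> \<alpha>"
    if I0: "I0 \<subseteq> {1..}" and indep: "\<forall>i\<ge>1. independent_of_past M P i"
      and valid: "\<forall>i\<in>I0. valid_pvalue M (P i)"
      and unif: "\<forall>i\<in>I0. \<not> (AE \<omega> in M. \<tau> i \<omega> = 1) \<longrightarrow> uniformly_valid_pvalue M (P i)" for I0
  proof -
    \<comment> \<open>Indices outside \<open>I0\<close> get the empty set, so the union bound can
      run over all natural numbers.\<close>
    define R where "R i = (if i \<in> I0 then {\<omega>\<in>space M. P i \<omega> \<le> (\<tau> i \<omega> - lam i \<omega>) * a i \<omega>} else {})" for i
    define V where "V i \<omega> = ennreal (a i \<omega> * of_bool (lam i \<omega> < P i \<omega> \<and> P i \<omega> \<le> \<tau> i \<omega>))" for i \<omega>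
    have R_meas: "R i \<in> sets M" for i
    proof (cases "i \<in> I0")
      case True
      with I0 have "i \<ge> 1" by auto
      note [measurable] = M_meas[OF this] P[OF this]
      show ?thesis using True by (simp add: R_def)
    qed (simp add: R_def)
    have V_meas: "V i \<in> borel_measurable M" if "i \<ge> 1" for i
    proof -
      note [measurable] = M_meas[OF that] P[OF that]
      show ?thesis unfolding V_def by measurable
    qed
    have R_le: "emeasure M (R i) \<le> (\<integral>\<^sup>+ \<omega>. V i \<omega> \<partial>M)" if i: "i \<ge> 1" for i
    proof (cases "i \<in> I0")
      case True
      have "a i \<omega> \<in> {0..1}" if "\<omega> \<in> space M" for \<omega>
        using a_nonneg[OF i that] a_le[OF i that] \<alpha> by simp
      then show ?thesis
        using True i indep valid unif P01 \<tau>[OF i] lam[OF i] a_meas \<tau>_meas lam_meas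
        unfolding R_def V_def by (simp only: if_True) (rule emeasure_rejection_le[OF P i]; simp)
    qed (simp add: R_def)
    \<comment> \<open>\<open>I0\<close> may be infinite, so the budget is applied to partial sums
      with a bound independent of \<open>n\<close>.\<close>
    have finite_bound: "(\<Sum>i<n. emeasure M (R i)) \<le> ennreal \<alpha>" for n
    proof -
      have "R 0 = {}" using I0 by (auto simp: R_def)
      then have "(\<Sum>i<n. emeasure M (R i)) = (\<Sum>i\<in>{1..<n}. emeasure M (R i))"
        by (intro sum.mono_neutral_right) (auto simp: not_less_eq_eq)
      also have "\<dots> \<le> (\<Sum>i\<in>{1..n}. emeasure M (R i))"
        by (intro sum_mono2) auto
      also have "\<dots> \<le> (\<Sum>i\<in>{1..n}. \<integral>\<^sup>+ \<omega>. V i \<omega> \<partial>M)"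
        using R_le by (intro sum_mono) auto
      also have "\<dots> = (\<integral>\<^sup>+ \<omega>. (\<Sum>i\<in>{1..n}. V i \<omega>) \<partial>M)"
        using V_meas by (intro nn_integral_sum[symmetric]) auto
      \<comment> \<open>The budget inequality holds at every sample point, and the total mass is
        one.\<close>
      also have "\<dots> \<le> (\<integral>\<^sup>+ \<omega>. ennreal \<alpha> \<partial>M)"
      proof (rule nn_integral_mono)
        fix \<omega> assume \<omega>: "\<omega> \<in> space M"
        have "(\<Sum>i\<in>{1..n}. V i \<omega>) = (\<Sum>i\<in>{1..n}. ennreal (a i \<omega> * u i \<omega>))"
          using \<omega> by (intro sum.cong) (auto simp: V_def u_eq)
        also have "\<dots> = ennreal (\<Sum>i\<in>{1..n}. a i \<omega> * u i \<omega>)"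
          using a_nonneg u01 \<omega> by (intro sum_ennreal) auto
        finally show "(\<Sum>i\<in>{1..n}. V i \<omega>) \<le> ennreal \<alpha>"
          using spent[OF \<omega>] by (simp add: ennreal_leI)
      qed
      finally show ?thesis by (simp add: emeasure_space_1)
    qed
    have "{\<omega>\<in>space M. \<exists>i\<in>I0. P i \<omega> \<le> ?level i \<omega>} = (\<Union>i. R i)"
    proof -
      have "R i = {\<omega>\<in>space M. i \<in> I0 \<and> P i \<omega> \<le> ?level i \<omega>}" for i
        using I0 level[of i] by (cases "i \<in> I0") (auto simp: R_def)
      then show ?thesis by auto
    qed
    moreover have "emeasure M (\<Union>i. R i) \<le> (\<Sum>i. emeasure M (R i))"
      using R_meas by (intro emeasure_subadditive_countably) auto
    moreover have "(\<Sum>i. emeasure M (R i)) \<le> ennreal \<alpha>"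
      using finite_bound by (intro suminf_le_const) auto
    ultimately have "ennreal (FWER M P ?level I0) \<le> ennreal \<alpha>"
      unfolding FWER_def emeasure_eq_measure[symmetric] by simp
    with \<alpha> show ?thesis by simp
  qed
  with spent show ?thesis unfolding a_def u_def by blast
qed

end
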